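(* Consider the Online Interval Selection problem with revocable acceptances, on inputs that are simple chains, in the (any order) adversarial model. No deterministic algorithm with revoking can achieve an asymptotic competitive ratio better than $3/4$. That is, for every deterministic online algorithm $\mathrm{ALG}$ with revoking, if $\rho$ and $b$ are real numbers such that $\mathrm{ALG}(I)\ge \rho\cdot\mathrm{OPT}(I)-b$ for every finite simple chain $I$ presented in any arrival order, then $\rho\le 3/4$.
   Context: A simple chain of size $n$ is a set of $n$ unit-length intervals $I_1,\dots,I_n$ on the real line, numbered from left to right, such that $I_i$ and $I_j$ ($i\neq j$) overlap if and only if $|i-j|=1$ (the intersection graph is a path on $n$ vertices in this order). Online Interval Selection with revocable acceptances (unweighted): intervals (given by their endpoints) arrive one by one; on arrival of each interval a deterministic online algorithm, based only on the sequence of intervals that have arrived so far, either rejects it permanently or accepts it, and it may permanently revoke previously accepted intervals; rejected or revoked intervals can never be selected later. At all times the currently selected intervals must be pairwise non-overlapping. $\mathrm{ALG}(I)$ is the number of intervals selected at the end on the input sequence $I$, and $\mathrm{OPT}(I)$ is the maximum number of pairwise non-overlapping intervals in $I$. Adversarial (any order) model: the adversary chooses both the set of intervals and the order in which they arrive (arbitrary, not necessarily sorted). *)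

theory Defs
  imports Complex_Main "HOL-Library.Sublist"
begin

text \<open>An interval is given by its two endpoints. It is read as half-open, so intervals that
  merely touch at an endpoint do not overlap.\<close>

type_synonym interval = "real \<times> real"

definition points :: "interval \<Rightarrow> real set" where
  "points I = {fst I..<snd I}"

definition overlap :: "interval \<Rightarrow> interval \<Rightarrow> bool" where
  "overlap I J \<longleftrightarrow> points I \<inter> points J \<noteq> {}"

definition nonoverlapping :: "interval set \<Rightarrow> bool" where
  "nonoverlapping S \<longleftrightarrow> pairwise (\<lambda>I J. \<not> overlap I J) S"

definition simple_chain :: "nat \<Rightarrow> interval set \<Rightarrow> bool" where
  "simple_chain n S \<longleftrightarrow>
    (\<exists>I :: nat \<Rightarrow> interval.
       bij_betw I {1..n} S \<and>
       (\<forall>i\<in>{1..n}. snd (I i) - fst (I i) = 1) \<and>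
       strict_mono_on {1..n} (\<lambda>i. fst (I i)) \<and>
       (\<forall>i\<in>{1..n}. \<forall>j\<in>{1..n}. i \<noteq> j \<longrightarrow>
          (overlap (I i) (I j) \<longleftrightarrow> \<bar>int i - int j\<bar> = 1)))"

text \<open>An input is a nonempty simple chain, listed in order of arrival.\<close>

definition chain_input :: "interval list \<Rightarrow> bool" where
  "chain_input \<sigma> \<longleftrightarrow> distinct \<sigma> \<and> (\<exists>n\<ge>1. simple_chain n (set \<sigma>))"

text \<open>A deterministic online algorithm is a function \<open>A\<close> from the sequence of intervals that have
  arrived so far to the set of currently selected ones. On each arrival, the new interval may be
  accepted and any previously selected ones revoked; nothing else can become selected. Since the
  intervals of an input are distinct, a rejected or revoked interval never returns. The
  constraints concern only the sequences that can occur while a chain is being presented,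
  so \<open>A\<close> may rely on the input being a chain.\<close>

definition revoking_algorithm :: "(interval list \<Rightarrow> interval set) \<Rightarrow> bool" where
  "revoking_algorithm A \<longleftrightarrow>
    A [] = {} \<and>
    (\<forall>\<sigma> xs x. chain_input \<sigma> \<and> prefix (xs @ [x]) \<sigma> \<longrightarrow>
       A (xs @ [x]) \<subseteq> insert x (A xs) \<and> nonoverlapping (A (xs @ [x])))"

definition ALG :: "(interval list \<Rightarrow> interval set) \<Rightarrow> interval list \<Rightarrow> nat" where
  "ALG A \<sigma> = card (A \<sigma>)"

definition OPT :: "interval list \<Rightarrow> nat" where
  "OPT \<sigma> = Max (card ` {T. T \<subseteq> set \<sigma> \<and> nonoverlapping T})"

end

theory Submission
  imports Defs
begin

text \<open>The adversary first presents widely separated pairs of overlapping intervals. The algorithm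
  holds at most one interval of each pair; call a pair right if it holds the right one and left
  otherwise. Consecutive pairs are then linked by one new interval if they have the same type and
  by two if they differ. A pair of equal type costs 3 intervals of the chain and yields at most 1
  selected one. The links from left to right and from right to left pairs alternate; the former
  yield a new interval without conflict, the latter are blocked on both sides, so that together
  they cost 8 intervals of the chain and yield at most 3. As the optimum is half of the length of
  the chain, the ratio is at most 3/4.\<close>

section \<open>Unit intervals and chains given by left endpoints\<close>

definition unit_interval :: "real \<Rightarrow> interval" where
  "unit_interval x = (x, x + 1)"

lemma inj_unit_interval: "inj unit_interval"
  by (auto simp: inj_def unit_interval_def)

lemma overlap_unit_interval:
  "overlap (unit_interval x) (unit_interval y) \<longleftrightarrow> \<bar>x - y\<bar> < 1"
proof
  assume "overlap (unit_interval x) (unit_interval y)"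
  then show "\<bar>x - y\<bar> < 1"
    by (auto simp: overlap_def points_def unit_interval_def)
next
  assume "\<bar>x - y\<bar> < 1"
  then have "max x y \<in> points (unit_interval x) \<inter> points (unit_interval y)"
    by (auto simp: points_def unit_interval_def)
  then show "overlap (unit_interval x) (unit_interval y)"
    unfolding overlap_def by blast
qed

text \<open>A gap below 1 makes neighbours overlap. Gaps of at least 1/2 put left endpoints two or
  more places apart at distance at least 1, where half-open unit intervals are disjoint.\<close>

lemma simple_chain_unit_intervals:
  assumes gaps: "successively (\<lambda>x y. x + 1/2 \<le> y \<and> y < x + 1) xs"
  shows "simple_chain (length xs) (unit_interval ` set xs)"
proof -
  have step: "xs ! i + 1/2 \<le> xs ! Suc i \<and> xs ! Suc i < xs ! i + 1" if "Suc i < length xs" for i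
    using gaps that by (auto simp: successively_conv_nth)
  have far: "xs ! i + real k / 2 \<le> xs ! (i + k)" if "i + k < length xs" for i k
    using that
  proof (induction k)
    case (Suc k)
    then show ?case using step[of "i + k"] by (simp add: field_simps)
  qed simp
  have less: "xs ! i < xs ! j" if "i < j" "j < length xs" for i j
  proof -
    have "0 < real (j - i) / 2" using that by simp
    then show ?thesis using far[of i "j - i"] that by (simp del: of_nat_diff)
  qed
  have dist: "\<bar>xs ! i - xs ! j\<bar> < 1 \<longleftrightarrow> j = Suc i" if "i < j" "j < length xs" for i j
  proof (cases "j = Suc i")
    case True
    then have "xs ! i + 1/2 \<le> xs ! j \<and> xs ! j < xs ! i + 1" using step[of i] that by simp
    then show ?thesis using True unfolding abs_less_iff by linarith
  next
    case False
    then have "2 \<le> j - i" using that by simp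
    then have "1 \<le> real (j - i) / 2" by linarith
    then have "xs ! i + 1 \<le> xs ! j" using far[of i "j - i"] that by (simp del: of_nat_diff)
    then show ?thesis using False by simp
  qed
  \<comment> \<open>The shift reconciles list positions, which start at 0, with the numbering of a
    chain from 1.\<close>
  define I where "I = (\<lambda>i. unit_interval (xs ! (i - 1)))"
  have mono: "strict_mono_on {1..length xs} (\<lambda>i. fst (I i))"
  proof (rule strict_mono_onI)
    fix i j assume "i \<in> {1..length xs}" "j \<in> {1..length xs}" "i < j"
    then show "fst (I i) < fst (I j)"
      using less[of "i - 1" "j - 1"] by (simp add: I_def unit_interval_def)
  qed
  have inj: "inj_on I {1..length xs}"
    using strict_mono_on_imp_inj_on[OF mono] by (simp add: inj_on_def)
  have "I ` {1..length xs} = unit_interval ` set xs"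
  proof -
    have "set xs = (\<lambda>i. xs ! (i - 1)) ` {1..length xs}"
    proof (intro equalityI subsetI)
      fix x assume "x \<in> set xs"
      then obtain i where "i < length xs" "x = xs ! i" by (auto simp: in_set_conv_nth)
      then show "x \<in> (\<lambda>i. xs ! (i - 1)) ` {1..length xs}"
        by (intro image_eqI[of _ _ "Suc i"]) auto
    qed auto
    then show ?thesis by (simp add: I_def image_image)
  qed
  moreover have "overlap (I i) (I j) \<longleftrightarrow> \<bar>int i - int j\<bar> = 1"
    if "i \<in> {1..length xs}" "j \<in> {1..length xs}" "i \<noteq> j" for i j
  proof (cases "i < j")
    case True
    then show ?thesis
      using that dist[of "i - 1" "j - 1"] by (auto simp: I_def overlap_unit_interval)
  next
    case False
    then show ?thesis
      using that dist[of "j - 1" "i - 1"]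
      by (auto simp: I_def overlap_unit_interval abs_minus_commute)
  qed
  ultimately show ?thesis
    unfolding simple_chain_def using mono inj
    by (intro exI[of _ I]) (auto simp: bij_betw_def I_def unit_interval_def)
qed

section \<open>Lower bound on the optimum\<close>

text \<open>Indices of equal parity never differ by 1, so both parity classes are feasible
  selections, and the larger one has at least half of the chain.\<close>

lemma OPT_ge_half_chain:
  assumes "simple_chain n (set \<sigma>)"
  shows "n \<le> 2 * OPT \<sigma>"
proof -
  from assms obtain I where bij: "bij_betw I {1..n} (set \<sigma>)"
    and ov: "\<And>i j. i \<in> {1..n} \<Longrightarrow> j \<in> {1..n} \<Longrightarrow> i \<noteq> j \<Longrightarrow>
      overlap (I i) (I j) \<longleftrightarrow> \<bar>int i - int j\<bar> = 1"
    unfolding simple_chain_def by blast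
  have le: "card (I ` {i \<in> {1..n}. even i = e}) \<le> OPT \<sigma>" for e
  proof -
    let ?T = "I ` {i \<in> {1..n}. even i = e}"
    have "nonoverlapping ?T"
      unfolding nonoverlapping_def
    proof (rule pairwiseI)
      fix x y assume "x \<in> ?T" "y \<in> ?T" "x \<noteq> y"
      then obtain i j where ij: "i \<in> {1..n}" "j \<in> {1..n}" "even i = even j" "i \<noteq> j"
        "x = I i" "y = I j" by blast
      have "\<bar>int i - int j\<bar> \<noteq> 1" using ij(3) by presburger
      then show "\<not> overlap x y" using ov ij by blast
    qed
    moreover have "?T \<subseteq> set \<sigma>" using bij by (auto simp: bij_betw_def)
    ultimately show ?thesis
      unfolding OPT_def by (intro Max_ge) auto
  qed
  have card_I: "card (I ` {i \<in> {1..n}. even i = e}) = card {i \<in> {1..n}. even i = e}" for e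
    using bij by (intro card_image) (auto simp: bij_betw_def intro: inj_on_subset)
  have "{1..n} = {i \<in> {1..n}. even i = True} \<union> {i \<in> {1..n}. even i = False}" by auto
  then have "n \<le> card {i \<in> {1..n}. even i = True} + card {i \<in> {1..n}. even i = False}"
    by (metis (no_types, lifting) card_Un_le card_atLeastAtMost diff_Suc_1)
  then show ?thesis using le[of True] le[of False] unfolding card_I by linarith
qed

section \<open>The online rules over blocks of arrivals\<close>

text \<open>Iterates the rule for one arrival. With the pairs as \<open>xs\<close> and the links as
  \<open>ys\<close>, it shows that no pair interval becomes selected while the links arrive.\<close>

lemma revoking_algorithm_append:
  assumes "revoking_algorithm A" "chain_input \<sigma>" "prefix (xs @ ys) \<sigma>"
  shows "A (xs @ ys) \<subseteq> A xs \<union> set ys"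
  using assms(3)
proof (induction ys rule: rev_induct)
  case (snoc y ys)
  have "A ((xs @ ys) @ [y]) \<subseteq> insert y (A (xs @ ys))"
    using assms(1,2) snoc.prems unfolding revoking_algorithm_def append_assoc[symmetric] by blast
  moreover have "A (xs @ ys) \<subseteq> A xs \<union> set ys"
    using snoc by (metis append_assoc append_prefixD)
  ultimately show ?case by auto
qed simp

lemma revoking_algorithm_nonoverlapping:
  assumes "revoking_algorithm A" "chain_input \<sigma>" "prefix xs \<sigma>"
  shows "nonoverlapping (A xs)"
proof (cases xs rule: rev_cases)
  case Nil
  then show ?thesis using assms(1) by (simp add: revoking_algorithm_def nonoverlapping_def)
next
  case (snoc ys y)
  then show ?thesis using assms unfolding revoking_algorithm_def by blast
qed

section \<open>The linked chain and the count of selected intervals\<close>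

text \<open>The predicate \<open>r\<close> tells which pairs are right. All gaps between consecutive left endpoints
  lie in \<open>[1/2, 1)\<close>, whichever link is used.\<close>

definition link :: "(nat \<Rightarrow> bool) \<Rightarrow> nat \<Rightarrow> real list" where
  "link r j = (if r j = r (Suc j) then [2 * j + 5/4] else [2 * j + 1, 2 * j + 3/2])"

fun linked_pairs :: "(nat \<Rightarrow> bool) \<Rightarrow> nat \<Rightarrow> real list" where
  "linked_pairs r 0 = [0, 1/2]"
| "linked_pairs r (Suc j) =
    linked_pairs r j @ link r j @ [2 * real (Suc j), 2 * real (Suc j) + 1/2]"

lemma last_linked_pairs: "linked_pairs r m \<noteq> [] \<and> last (linked_pairs r m) = 2 * real m + 1/2"
  by (cases m) auto

lemma successively_linked_pairs:
  "successively (\<lambda>x y. x + 1/2 \<le> y \<and> y < x + 1) (linked_pairs r m)"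
  by (induction m)
    (auto simp: successively_append_iff last_linked_pairs link_def field_simps)

lemma distinct_linked_pairs: "distinct (linked_pairs r m)"
proof -
  have "successively (<) (linked_pairs r m)"
    by (rule successively_mono[OF successively_linked_pairs]) auto
  then show ?thesis
    by (simp add: strict_sorted_iff successively_conv_sorted_wrt)
qed

text \<open>The positions of the pairs are the same for every \<open>r\<close>, so the pairs can be
  presented before \<open>r\<close> is known.\<close>

lemma pairs_subset_linked_pairs:
  "j \<le> m \<Longrightarrow> {2 * real j, 2 * real j + 1/2} \<subseteq> set (linked_pairs r m)"
proof (induction m)
  case (Suc m)
  then show ?case by (cases "j = Suc m") auto
qed auto

lemma length_linked_pairs_ge: "m \<le> length (linked_pairs r m)"
  by (induction m) (auto simp: link_def)

text \<open>If the last pair is right, its interval is not counted yet: it competes with the next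
  link.\<close>

lemma selected_linked_pairs_aux:
  assumes sep: "\<And>x y. P x \<Longrightarrow> P y \<Longrightarrow> x < y \<Longrightarrow> x + 1 \<le> (y :: real)"
    and right: "\<And>j. j \<le> m \<Longrightarrow> r j \<Longrightarrow> \<not> P (2 * real j)"
    and left: "\<And>j. j \<le> m \<Longrightarrow> \<not> r j \<Longrightarrow> \<not> P (2 * real j + 1/2)"
  shows "if r m
    then 8 * length (filter P (linked_pairs r m)) + 2
      \<le> 3 * length (linked_pairs r m) + 8 * of_bool (P (2 * real m + 1/2))
    else 8 * length (filter P (linked_pairs r m)) \<le> 3 * length (linked_pairs r m) + 2"
  using right left
proof (induction m)
  case 0
  then show ?case by auto
next
  case (Suc m)
  let ?x = "2 * real m"
  \<comment> \<open>Both shapes of link are covered. The interval at \<open>?x + 5/4\<close> is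
    blocked by either adjacent one; two link intervals block each other and the neighbour on their
    own side.\<close>
  have conflicts:
    "\<not> (P (?x + 1/2) \<and> P (?x + 5/4))" "\<not> (P (?x + 5/4) \<and> P (?x + 2))"
    "\<not> (P (?x + 1/2) \<and> P (?x + 1))" "\<not> (P (?x + 1) \<and> P (?x + 3/2))"
    "\<not> (P (?x + 3/2) \<and> P (?x + 2))"
    using sep[of "?x + 1/2" "?x + 5/4"] sep[of "?x + 5/4" "?x + 2"]
      sep[of "?x + 1/2" "?x + 1"] sep[of "?x + 1" "?x + 3/2"] sep[of "?x + 3/2" "?x + 2"]
    by auto
  have shift: "2 * real (Suc m) = ?x + 2" by simp
  note IH = Suc.IH[OF Suc.prems(1)[OF le_SucI] Suc.prems(2)[OF le_SucI]]
  have new: "r (Suc m) \<Longrightarrow> \<not> P (?x + 2)" "\<not> r (Suc m) \<Longrightarrow> \<not> P (?x + 2 + 1/2)"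
    using Suc.prems[of "Suc m"] unfolding shift by auto
  \<comment> \<open>Without the pending right interval, 8 times the selected number minus 3 times
    the length is at most 2 after a left pair and -2 after a right one. Going from left to right
    adds at most 8 - 12 = -4, from right to left at most 16 - 12 = 4, and equal types at most 8 - 9
    = -1. The split on \<open>P (?x + 1/2)\<close> settles whether the pending interval
    counts.\<close>
  show ?case
    using IH new conflicts
    unfolding linked_pairs.simps link_def shift
    by (cases "r m"; cases "r (Suc m)"; cases "P (?x + 1/2)"; simp split: if_splits)
qed

text \<open>The worst end is a right pair whose pending interval is selected, which gives 8 - 2 = 6;
  a left end gives 2.\<close>

lemma selected_linked_pairs:
  assumes "\<And>x y. P x \<Longrightarrow> P y \<Longrightarrow> x < y \<Longrightarrow> x + 1 \<le> (y :: real)"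
    and "\<And>j. j \<le> m \<Longrightarrow> r j \<Longrightarrow> \<not> P (2 * real j)"
    and "\<And>j. j \<le> m \<Longrightarrow> \<not> r j \<Longrightarrow> \<not> P (2 * real j + 1/2)"
  shows "8 * length (filter P (linked_pairs r m)) \<le> 3 * length (linked_pairs r m) + 6"
  using selected_linked_pairs_aux[of P m r] assms by (auto split: if_splits simp: of_bool_def)

section \<open>Playing against the algorithm\<close>

lemma adversary:
  assumes A: "revoking_algorithm A"
  obtains \<sigma> n where "chain_input \<sigma>" "simple_chain n (set \<sigma>)" "m \<le> n" "8 * ALG A \<sigma> \<le> 3 * n + 6"
proof -
  define B where "B = (\<Union>j\<le>m. {2 * real j, 2 * real j + 1/2})"
  have fin: "finite (unit_interval ` B)" by (simp add: B_def)
  obtain \<sigma>0 where \<sigma>0: "set \<sigma>0 = unit_interval ` B" "distinct \<sigma>0"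
    using finite_distinct_list[OF fin] by auto
  \<comment> \<open>Determinism fixes the types from \<open>\<sigma>0\<close> alone. A pair of which
    nothing is held counts as left, since a left pair only has to lack its right interval.\<close>
  define r where "r j \<longleftrightarrow> unit_interval (2 * real j + 1/2) \<in> A \<sigma>0" for j
  let ?xs = "linked_pairs r m"
  define \<sigma>1 where "\<sigma>1 = filter (\<lambda>x. x \<notin> set \<sigma>0) (map unit_interval ?xs)"
  have "B \<subseteq> set ?xs" unfolding B_def using pairs_subset_linked_pairs by blast
  then have set\<sigma>: "set (\<sigma>0 @ \<sigma>1) = unit_interval ` set ?xs"
    by (auto simp: \<sigma>1_def \<sigma>0)
  have "distinct (\<sigma>0 @ \<sigma>1)"
    using \<sigma>0(2) distinct_linked_pairs[of r m] inj_on_subset[OF inj_unit_interval]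
    by (simp add: \<sigma>1_def distinct_map distinct_filter disjoint_iff)
  moreover have chain: "simple_chain (length ?xs) (set (\<sigma>0 @ \<sigma>1))"
    unfolding set\<sigma> by (rule simple_chain_unit_intervals[OF successively_linked_pairs])
  moreover have "1 \<le> length ?xs"
    using last_linked_pairs[of r m] by (simp add: Suc_le_eq)
  ultimately have input: "chain_input (\<sigma>0 @ \<sigma>1)"
    unfolding chain_input_def by blast
  \<comment> \<open>The online rules bind \<open>A\<close> on \<open>\<sigma>0\<close> as a prefix
    of the completed chain, so \<open>input\<close> has to be established first.\<close>
  have sub0: "A \<sigma>0 \<subseteq> set \<sigma>0" and sub: "A (\<sigma>0 @ \<sigma>1) \<subseteq> A \<sigma>0 \<union> set \<sigma>1"
    using revoking_algorithm_append[OF A input, of "[]" \<sigma>0]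
      revoking_algorithm_append[OF A input, of \<sigma>0 \<sigma>1] A
    by (auto simp: revoking_algorithm_def)
  have no0: "nonoverlapping (A \<sigma>0)" and no: "nonoverlapping (A (\<sigma>0 @ \<sigma>1))"
    using revoking_algorithm_nonoverlapping[OF A input] by auto
  \<comment> \<open>\<open>\<sigma>1\<close> omits the intervals of \<open>\<sigma>0\<close>, so a
    pair interval selected at the end must already have been held when the links began.\<close>
  have kept: "x \<in> A \<sigma>0" if "x \<in> A (\<sigma>0 @ \<sigma>1)" "x \<in> set \<sigma>0" for x
    using that sub by (auto simp: \<sigma>1_def)
  define P where "P x \<longleftrightarrow> unit_interval x \<in> A (\<sigma>0 @ \<sigma>1)" for x
  have pair: "unit_interval (2 * real j) \<in> set \<sigma>0" "unit_interval (2 * real j + 1/2) \<in> set \<sigma>0"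
    if "j \<le> m" for j
    using that unfolding \<sigma>0 B_def by auto
  have "8 * length (filter P ?xs) \<le> 3 * length ?xs + 6"
  proof (rule selected_linked_pairs)
    fix x y assume "P x" "P y" "x < y"
    then have "\<not> overlap (unit_interval x) (unit_interval y)"
      using no by (auto simp: P_def nonoverlapping_def pairwise_def unit_interval_def)
    then show "x + 1 \<le> y" using \<open>x < y\<close> by (simp add: overlap_unit_interval)
  next
    fix j assume j: "j \<le> m" and "r j"
    have "overlap (unit_interval (2 * real j)) (unit_interval (2 * real j + 1/2))"
      by (simp add: overlap_unit_interval)
    then have "unit_interval (2 * real j) \<notin> A \<sigma>0"
      using no0 \<open>r j\<close> by (auto simp: r_def nonoverlapping_def pairwise_def unit_interval_def)
    then show "\<not> P (2 * real j)" using kept pair[OF j] unfolding P_def by blast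
  next
    fix j assume j: "j \<le> m" and "\<not> r j"
    then show "\<not> P (2 * real j + 1/2)" using kept pair[OF j] unfolding P_def r_def by blast
  qed
  moreover have "length (filter P ?xs) = ALG A (\<sigma>0 @ \<sigma>1)"
  proof -
    have "A (\<sigma>0 @ \<sigma>1) \<subseteq> unit_interval ` set ?xs"
      unfolding set\<sigma>[symmetric] using sub sub0 by auto
    then have "A (\<sigma>0 @ \<sigma>1) = unit_interval ` set (filter P ?xs)"
      unfolding P_def set_filter by blast
    then have "ALG A (\<sigma>0 @ \<sigma>1) = card (set (filter P ?xs))"
      unfolding ALG_def using inj_unit_interval by (metis card_image inj_on_subset subset_UNIV)
    then show ?thesis
      using distinct_card[of "filter P ?xs"] distinct_linked_pairs[of r m] by simp
  qed
  ultimately show thesis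
    using that[OF input chain length_linked_pairs_ge] by simp
qed

theorem theorem10:
  fixes A :: "interval list \<Rightarrow> interval set" and \<rho> b :: real
  assumes "revoking_algorithm A"
    and "\<And>\<sigma>. chain_input \<sigma> \<Longrightarrow> real (ALG A \<sigma>) \<ge> \<rho> * real (OPT \<sigma>) - b"
  shows "\<rho> \<le> 3 / 4"
proof (rule ccontr)
  assume "\<not> \<rho> \<le> 3 / 4"
  then have \<rho>: "\<rho> - 3/4 > 0" by simp
  \<comment> \<open>Combining the assumed ratio with \<open>n / 2\<close> for the optimum and
    \<open>3/8 * n + 3/4\<close> for the algorithm bounds \<open>n * (\<rho> - 3/4)\<close> by
    \<open>2 * b + 3/2\<close>; a long enough chain exceeds this.\<close>
  obtain m :: nat where m: "2 * b + 3/2 < real m * (\<rho> - 3/4)"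
    using reals_Archimedean3[OF \<rho>] by blast
  obtain \<sigma> n where \<sigma>: "chain_input \<sigma>" "simple_chain n (set \<sigma>)" "m \<le> n"
    "8 * ALG A \<sigma> \<le> 3 * n + 6"
    using adversary[OF assms(1)] by blast
  have "real n / 2 \<le> real (OPT \<sigma>)" using OPT_ge_half_chain[OF \<sigma>(2)] by linarith
  then have "\<rho> * (real n / 2) \<le> \<rho> * real (OPT \<sigma>)" using \<rho> by (intro mult_left_mono) auto
  moreover have "real (ALG A \<sigma>) \<le> 3/8 * real n + 3/4" using \<sigma>(4) by linarith
  ultimately have "real n * (\<rho> - 3/4) \<le> 2 * b + 3/2"
    using assms(2)[OF \<sigma>(1)] by (simp add: algebra_simps)
  moreover have "real m * (\<rho> - 3/4) \<le> real n * (\<rho> - 3/4)"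
    using \<sigma>(3) \<rho> by (intro mult_right_mono) auto
  ultimately show False using m by linarith
qed

end
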